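(* Let $k \ge t \ge 1$ be fixed integers. For each $v \ge k$, let $\mathcal{C}_v$ be the $(v,k,t)$ covering produced by the random greedy covering algorithm (the greedy algorithm with uniformly random ordering of the $k$-subsets of a $v$-set). Then the expected density of $\mathcal{C}_v$ is $1 + o(1)$ as $v \to \infty$.
   Context: A $(v,k,t)$ covering is a family of $k$-subsets, called blocks, of a fixed $v$-set such that every $t$-subset of the $v$-set is contained in at least one block. Its size is the number of blocks, and its density is the average, over all $t$-subsets, of the number of blocks containing the $t$-subset; equivalently, the density is $(\text{number of blocks}) \cdot \binom{k}{t} / \binom{v}{t}$. Random greedy $(v,k,t)$ covering algorithm: (1) Fix a uniformly random ordering of all $k$-subsets of the $v$-set. (2) Choose the earliest $k$-set in the ordering that contains no already-covered $t$-set (a $t$-set is already covered if it is contained in a previously chosen $k$-set). (3) Repeat step (2) until no $k$-set can be chosen. (4) For each $t$-set that is still uncovered at this point, add one $k$-set containing it. The output is the family of all $k$-sets chosen in steps (2)-(3) together with those added in step (4). The expectation is over the random ordering. *)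

theory Defs
  imports
    "HOL-Probability.Probability"
    "HOL-Library.Ramsey"
    "HOL-Combinatorics.Multiset_Permutations"
begin

definition covers :: "'a set set \<Rightarrow> 'a set \<Rightarrow> bool" where
  "covers F T \<longleftrightarrow> (\<exists>B\<in>F. T \<subseteq> B)"

definition is_covering :: "'a set \<Rightarrow> nat \<Rightarrow> nat \<Rightarrow> 'a set set \<Rightarrow> bool" where
  "is_covering V k t C \<longleftrightarrow> C \<subseteq> nsets V k \<and> (\<forall>T\<in>nsets V t. covers C T)"

definition covering_density :: "'a set \<Rightarrow> nat \<Rightarrow> 'a set set \<Rightarrow> real" where
  "covering_density V t C = (\<Sum>T\<in>nsets V t. real (card {B\<in>C. T \<subseteq> B})) / real (card (nsets V t))"

definition available :: "nat \<Rightarrow> 'a set set \<Rightarrow> 'a set \<Rightarrow> bool" where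
  "available t F K \<longleftrightarrow> (\<forall>T\<in>nsets K t. \<not> covers F T)"

text \<open>
  The argument \<open>L\<close> lists the candidate blocks in order; \<open>F\<close> is the family chosen so far.
  The recursion terminates when \<open>L\<close> consists of \<open>k\<close>-sets with \<open>t \<le> k\<close>, since a chosen block is
  then never available again; see \<open>greedy_properties\<close> below.
\<close>

partial_function (tailrec) greedy :: "nat \<Rightarrow> 'a set list \<Rightarrow> 'a set set \<Rightarrow> 'a set set" where
  "greedy t L F =
     (case List.find (available t F) L of
        None \<Rightarrow> F
      | Some K \<Rightarrow> greedy t L (insert K F))"

text \<open>
  The function \<open>c\<close> is the rule that assigns to each \<open>t\<close>-set left uncovered the block that is added
  for it.
\<close>

definition greedy_covering ::
    "'a set \<Rightarrow> nat \<Rightarrow> ('a set \<Rightarrow> 'a set) \<Rightarrow> 'a set list \<Rightarrow> 'a set set" where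
  "greedy_covering V t c L =
     (let F = greedy t L {} in F \<union> c ` {T \<in> nsets V t. \<not> covers F T})"

definition random_ordering :: "'a set \<Rightarrow> nat \<Rightarrow> 'a set list pmf" where
  "random_ordering V k = pmf_of_set (permutations_of_set (nsets V k))"

lemma covering_density_eq:
  assumes V: "finite V" and C: "C \<subseteq> nsets V k"
  shows "covering_density V t C = real (card C) * real (k choose t) / real (card V choose t)"
proof -
  have fin: "finite (nsets V t)" "finite C"
    using V C by (auto simp: finite_imp_finite_nsets intro: finite_subset)
  have card_nsets: "card (nsets A n) = card A choose n" if "finite A" for A :: "'a set" and n
  proof -
    have "nsets A n = {N. N \<subseteq> A \<and> card N = n}"
      using that by (auto simp: nsets_def intro: finite_subset)
    then show ?thesis using n_subsets[OF that] by simp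
  qed
  have "(\<Sum>T\<in>nsets V t. card {B\<in>C. T \<subseteq> B}) = (\<Sum>B\<in>C. card {T\<in>nsets V t. T \<subseteq> B})"
    using sum_multicount_gen[OF fin, of "\<lambda>T B. T \<subseteq> B" "\<lambda>B. card {T\<in>nsets V t. T \<subseteq> B}"] by simp
  also have "\<dots> = (\<Sum>B\<in>C. k choose t)"
  proof (rule sum.cong[OF refl])
    fix B assume "B \<in> C"
    with C have B: "B \<subseteq> V" "finite B" "card B = k" by (auto simp: nsets_def)
    have "{T\<in>nsets V t. T \<subseteq> B} = nsets B t" using B(1) by (auto simp: nsets_def)
    then show "card {T\<in>nsets V t. T \<subseteq> B} = k choose t" using card_nsets B by simp
  qed
  finally have "(\<Sum>T\<in>nsets V t. card {B\<in>C. T \<subseteq> B}) = card C * (k choose t)" by simp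
  then have "(\<Sum>T\<in>nsets V t. real (card {B\<in>C. T \<subseteq> B})) = real (card C) * real (k choose t)"
    by (simp flip: of_nat_mult of_nat_sum)
  then show ?thesis using card_nsets[OF V] by (simp add: covering_density_def)
qed

lemma greedy_properties:
  assumes L: "\<And>K. K \<in> set L \<Longrightarrow> finite K \<and> t \<le> card K"
  shows "F \<subseteq> greedy t L F \<and> greedy t L F \<subseteq> F \<union> set L \<and>
    (\<forall>K\<in>set L. \<not> available t (greedy t L F) K)"
proof (induction "card (set L - F)" arbitrary: F rule: less_induct)
  case less
  show ?case
  proof (cases "List.find (available t F) L")
    case None
    then have "greedy t L F = F" by (subst greedy.simps) simp
    with None show ?thesis by (auto simp: find_None_iff)
  next
    case (Some K)
    then have eq: "greedy t L F = greedy t L (insert K F)" by (subst greedy.simps) simp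
    have K: "K \<in> set L" "available t F K" using Some by (auto simp: find_Some_iff)
    obtain T where "T \<subseteq> K" "card T = t" "finite T"
      using L[OF K(1)] obtain_subset_with_card_n[of t K] by blast
    then have "T \<in> nsets K t" by (auto simp: nsets_def)
    with K(2) \<open>T \<subseteq> K\<close> have "K \<notin> F" by (auto simp: available_def covers_def)
    then have "card (set L - insert K F) < card (set L - F)"
      using K(1) by (intro psubset_card_mono) auto
    from less[OF this] show ?thesis using K(1) by (auto simp: eq)
  qed
qed

lemma greedy_covering_is_covering:
  assumes "t \<le> k" and L: "set L = nsets V k"
    and c: "\<And>T. T \<in> nsets V t \<Longrightarrow> c T \<in> nsets V k \<and> T \<subseteq> c T"
  shows "is_covering V k t (greedy_covering V t c L)"
proof -
  have "greedy t L {} \<subseteq> nsets V k"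
    using greedy_properties[of L t "{}"] assms(1) L by (auto simp: nsets_def)
  then have "greedy_covering V t c L \<subseteq> nsets V k"
    using c by (auto simp: greedy_covering_def Let_def)
  moreover have "covers (greedy_covering V t c L) T" if T: "T \<in> nsets V t" for T
  proof (cases "covers (greedy t L {}) T")
    case True
    then show ?thesis by (auto simp: greedy_covering_def Let_def covers_def)
  next
    case False
    then have "c T \<in> greedy_covering V t c L"
      using T by (auto simp: greedy_covering_def Let_def)
    then show ?thesis using c[OF T] by (auto simp: covers_def)
  qed
  ultimately show ?thesis by (simp add: is_covering_def)
qed

end

theory Submission
  imports Defs
begin

text \<open>
  It suffices that the probability of a fixed \<open>t\<close>-set remaining uncovered by the greedy packing
  tends to \<open>0\<close>. Let \<open>p\<^sub>m(S)\<close> be the probability that all \<open>t\<close>-sets in \<open>S\<close> are uncovered after \<open>m\<close>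
  blocks \<open>K\<close> have been inspected, and let \<open>Q = k choose t\<close>. These numbers satisfy the closed
  recursion \<open>p\<^sub>m\<^sub>+\<^sub>1(S) = p\<^sub>m(S) - (\<Sum>K hits S. p\<^sub>m(S \<union> nsets K t)) / (card E - m)\<close>. Most blocks
  hitting \<open>S\<close> do so in a single \<open>t\<close>-set, so a product ansatz \<open>p\<^sub>m(S) \<approx> x\<^sub>m ^ card S\<close> leads to
  \<open>x\<^sub>m\<^sub>+\<^sub>1 = x\<^sub>m - h\<^sub>m x\<^sub>m ^ Q\<close>, whose solution tends to \<open>0\<close> in the long run. The error for \<open>n\<close>
  \<open>t\<close>-sets is controlled by the error for \<open>n + Q - 1\<close> of them; iterating this over short time
  intervals and using the trivial bound \<open>1\<close> at the end shows that it vanishes as \<open>v \<rightarrow> \<infinity>\<close>.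
\<close>

subsection \<open>The greedy packing as a fold\<close>

definition greedy_step :: "nat \<Rightarrow> 'a set \<Rightarrow> 'a set set \<Rightarrow> 'a set set" where
  "greedy_step t K F = (if available t F K then insert K F else F)"

definition greedy_family :: "nat \<Rightarrow> 'a set list \<Rightarrow> 'a set set" where
  "greedy_family t w = fold (greedy_step t) w {}"

lemma greedy_family_Nil [simp]: "greedy_family t [] = {}"
  by (simp add: greedy_family_def)

lemma greedy_family_snoc [simp]:
  "greedy_family t (w @ [K]) = greedy_step t K (greedy_family t w)"
  by (simp add: greedy_family_def)

lemma not_available_mono: "\<not> available t F K \<Longrightarrow> F \<subseteq> F' \<Longrightarrow> \<not> available t F' K"
  by (auto simp: available_def covers_def)

lemma nsets_nonempty:
  assumes "t \<le> card K" shows "\<exists>T. T \<in> nsets K t"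
proof -
  obtain T where "T \<subseteq> K" "card T = t" "finite T"
    using obtain_subset_with_card_n[OF assms] by blast
  then show ?thesis by (auto simp: nsets_def)
qed

lemma not_available_insert:
  assumes "t \<le> card K" shows "\<not> available t (insert K F) K"
  using nsets_nonempty[OF assms] by (auto simp: available_def covers_def nsets_def)

lemma greedy_append_eq_fold:
  assumes "\<forall>K\<in>set (P @ S). t \<le> card K" and "\<forall>K\<in>set P. \<not> available t F K"
  shows "greedy t (P @ S) F = fold (greedy_step t) S F"
  using assms
proof (induction S arbitrary: P F)
  case Nil
  then have "List.find (available t F) P = None" by (auto simp: find_None_iff)
  then show ?case by (subst greedy.simps) simp
next
  case (Cons K S)
  show ?case
  proof (cases "available t F K")
    case True
    have "List.find (available t F) (P @ K # S) = Some K"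
      using Cons.prems(2) True by (induction P) auto
    then have "greedy t (P @ K # S) F = greedy t ((P @ [K]) @ S) (insert K F)"
      by (subst greedy.simps) simp
    also have "\<dots> = fold (greedy_step t) S (insert K F)"
    proof (rule Cons.IH)
      show "\<forall>K'\<in>set (P @ [K]). \<not> available t (insert K F) K'"
        using Cons.prems not_available_mono[of t F _ "insert K F"] not_available_insert[of t K F]
        by auto
    qed (use Cons.prems in auto)
    finally show ?thesis using True by (simp add: greedy_step_def[of t K F])
  next
    case False
    have "greedy t ((P @ [K]) @ S) F = fold (greedy_step t) S F"
      by (rule Cons.IH) (use Cons.prems False in auto)
    then show ?thesis using False by (simp add: greedy_step_def[of t K F])
  qed
qed

lemma greedy_eq_greedy_family:
  assumes "\<forall>K\<in>set L. t \<le> card K"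
  shows "greedy t L {} = greedy_family t L"
  using greedy_append_eq_fold[of "[]" L t "{}"] assms by (simp add: greedy_family_def)

lemma greedy_family_subset: "greedy_family t w \<subseteq> set w"
proof (induction w rule: rev_induct)
  case (snoc K w)
  then show ?case by (auto simp: greedy_step_def)
qed simp

lemma not_available_greedy_family:
  assumes "\<forall>K\<in>set w. t \<le> card K" and "K \<in> set w"
  shows "\<not> available t (greedy_family t w) K"
  using assms
proof (induction w rule: rev_induct)
  case (snoc K' w)
  have sub: "greedy_family t w \<subseteq> greedy_family t (w @ [K'])"
    by (auto simp: greedy_step_def)
  show ?case
  proof (cases "K \<in> set w")
    case True
    then show ?thesis using snoc not_available_mono[OF _ sub] by auto
  next
    case False
    then have "K = K'" using snoc by simp
    then show ?thesis using snoc.prems not_available_insert[of t K]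
      by (auto simp: greedy_step_def)
  qed
qed simp

lemma greedy_family_packing:
  "pairwise (\<lambda>K K'. nsets K t \<inter> nsets K' t = {}) (greedy_family t w)"
proof (induction w rule: rev_induct)
  case (snoc K w)
  have "nsets K t \<inter> nsets K' t = {}" if "available t (greedy_family t w) K" "K' \<in> greedy_family t w" for K'
    using that by (auto simp: available_def covers_def nsets_def)
  then show ?case using snoc by (auto simp: greedy_step_def pairwise_insert)
qed (simp add: pairwise_def)

subsection \<open>Probability of remaining uncovered\<close>

definition uncovered :: "'a set set \<Rightarrow> 'a set set \<Rightarrow> bool" where
  "uncovered F S \<longleftrightarrow> (\<forall>T\<in>S. \<not> covers F T)"

text \<open>\<open>S\<close> loses its status exactly when \<open>K\<close> hits \<open>S\<close>
  and is accepted, and acceptance means that \<open>nsets K t\<close> is uncovered. The loss is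
  therefore again an indicator of type \<open>uncovered\<close>, which closes the recursion.\<close>

lemma uncovered_snoc:
  assumes "finite K" "\<forall>T\<in>S. card T = t"
  shows "of_bool (uncovered (greedy_family t (w @ [K])) S) =
    of_bool (uncovered (greedy_family t w) S) -
    (if \<exists>T\<in>S. T \<subseteq> K then of_bool (uncovered (greedy_family t w) (S \<union> nsets K t)) else (0::real))"
  using assms
  by (auto simp: uncovered_def greedy_step_def available_def covers_def nsets_def ball_Un)

text \<open>The possible lists of the first \<open>m\<close> inspected blocks; a uniformly random
  word is distributed as a prefix of a uniformly random ordering of \<open>E\<close>.\<close>

definition words :: "'a set \<Rightarrow> nat \<Rightarrow> 'a list set" where
  "words E m = {w. set w \<subseteq> E \<and> distinct w \<and> length w = m}"

lemma finite_words: "finite E \<Longrightarrow> finite (words E m)"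
  by (rule finite_subset[OF _ finite_lists_length_eq[of E m]]) (auto simp: words_def)

lemma words_0 [simp]: "words E 0 = {[]}"
  by (auto simp: words_def)

lemma words_card_eq_permutations:
  assumes "finite E" shows "words E (card E) = permutations_of_set E"
proof -
  have "set w = E" if "set w \<subseteq> E" "distinct w" "length w = card E" for w
    using that assms by (metis card_subset_eq distinct_card)
  then show ?thesis by (auto simp: words_def permutations_of_set_def distinct_card)
qed

lemma sum_words_Suc:
  fixes g :: "'a list \<Rightarrow> 'b::comm_monoid_add"
  assumes "finite E"
  shows "(\<Sum>w\<in>words E (Suc m). g w) = (\<Sum>w\<in>words E m. \<Sum>e\<in>E - set w. g (w @ [e]))"
proof -
  have eq: "words E (Suc m) = (\<lambda>(w, e). w @ [e]) ` (SIGMA w:words E m. E - set w)"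
  proof (intro equalityI subsetI)
    fix w assume w: "w \<in> words E (Suc m)"
    then obtain w' e where "w = w' @ [e]" by (cases w rule: rev_cases) (auto simp: words_def)
    with w show "w \<in> (\<lambda>(w, e). w @ [e]) ` (SIGMA w:words E m. E - set w)"
      by (intro image_eqI[of _ _ "(w', e)"]) (auto simp: words_def)
  qed (auto simp: words_def)
  show ?thesis
    unfolding eq
    by (subst sum.reindex) (auto simp: inj_on_def sum.Sigma finite_words assms intro!: sum.cong)
qed

lemma card_words_Suc:
  assumes "finite E"
  shows "card (words E (Suc m)) = card (words E m) * (card E - m)"
proof -
  have "card (words E (Suc m)) = (\<Sum>w\<in>words E m. card (E - set w))"
    using sum_words_Suc[OF assms, of "\<lambda>_. 1::nat" m] by simp
  also have "\<dots> = (\<Sum>w\<in>words E m. card E - m)"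
    by (intro sum.cong) (auto simp: words_def card_Diff_subset distinct_card)
  finally show ?thesis by simp
qed

lemma card_words_pos: "finite E \<Longrightarrow> m \<le> card E \<Longrightarrow> card (words E m) > 0"
  by (induction m) (auto simp: card_words_Suc)

definition uncovered_prob :: "'a set set \<Rightarrow> nat \<Rightarrow> nat \<Rightarrow> 'a set set \<Rightarrow> real" where
  "uncovered_prob E t m S =
     (\<Sum>w\<in>words E m. of_bool (uncovered (greedy_family t w) S)) / card (words E m)"

lemma uncovered_prob_nonneg: "0 \<le> uncovered_prob E t m S"
  by (auto simp: uncovered_prob_def intro!: divide_nonneg_nonneg sum_nonneg)

lemma uncovered_prob_le_1: "uncovered_prob E t m S \<le> 1"
proof -
  have "(\<Sum>w\<in>words E m. of_bool (uncovered (greedy_family t w) S)) \<le> (\<Sum>w\<in>words E m. 1::real)"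
    by (intro sum_mono) auto
  then show ?thesis by (auto simp: uncovered_prob_def divide_le_eq_1)
qed

lemma uncovered_prob_0 [simp]: "uncovered_prob E t 0 S = 1"
  by (simp add: uncovered_prob_def uncovered_def covers_def)

text \<open>
  The next block \<open>K\<close> destroys the event that \<open>S\<close> is uncovered iff \<open>K\<close> hits \<open>S\<close> and
  \<open>S \<union> nsets K t\<close> is uncovered; in that case \<open>K\<close> has not occurred before, so it is the next block
  with probability exactly \<open>1 / (card E - m)\<close>.
\<close>

lemma uncovered_prob_Suc:
  fixes E :: "'a set set"
  assumes E: "finite E" "\<And>K. K \<in> E \<Longrightarrow> finite K \<and> t \<le> card K"
    and S: "\<forall>T\<in>S. card T = t" and m: "m < card E"
  shows "uncovered_prob E t (Suc m) S = uncovered_prob E t m S -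
    (\<Sum>K\<in>{K\<in>E. \<exists>T\<in>S. T \<subseteq> K}. uncovered_prob E t m (S \<union> nsets K t)) / (real (card E) - real m)"
proof -
  let ?H = "{K\<in>E. \<exists>T\<in>S. T \<subseteq> K}"
  let ?u = "\<lambda>w S. of_bool (uncovered (greedy_family t w) S) :: real"
  have "(\<Sum>w\<in>words E (Suc m). ?u w S) = (\<Sum>w\<in>words E m. \<Sum>K\<in>E - set w. ?u (w @ [K]) S)"
    by (rule sum_words_Suc) fact
  also have "\<dots> = (\<Sum>w\<in>words E m. (real (card E) - real m) * ?u w S - (\<Sum>K\<in>?H. ?u w (S \<union> nsets K t)))"
  proof (rule sum.cong[OF refl])
    fix w assume w: "w \<in> words E m"
    then have wE: "set w \<subseteq> E" "card (set w) = m" by (auto simp: words_def distinct_card)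
    have "(\<Sum>K\<in>E - set w. ?u (w @ [K]) S) =
        (\<Sum>K\<in>E - set w. ?u w S - (if \<exists>T\<in>S. T \<subseteq> K then ?u w (S \<union> nsets K t) else 0))"
      using E S by (intro sum.cong uncovered_snoc) auto
    also have "\<dots> = real (card (E - set w)) * ?u w S -
        (\<Sum>K\<in>E - set w. if \<exists>T\<in>S. T \<subseteq> K then ?u w (S \<union> nsets K t) else 0)"
      by (simp add: sum_subtractf)
    \<comment> \<open>Inspected blocks can be put back, because their terms vanish. The index set
      then no longer depends on \<open>w\<close>, so the sums can be exchanged.\<close>
    also have "(\<Sum>K\<in>E - set w. if \<exists>T\<in>S. T \<subseteq> K then ?u w (S \<union> nsets K t) else 0) =
        (\<Sum>K\<in>E. if \<exists>T\<in>S. T \<subseteq> K then ?u w (S \<union> nsets K t) else 0)"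
    proof (rule sum.mono_neutral_left)
      show "\<forall>K\<in>E - (E - set w). (if \<exists>T\<in>S. T \<subseteq> K then ?u w (S \<union> nsets K t) else 0) = 0"
      proof
        fix K assume "K \<in> E - (E - set w)"
        then have "\<not> available t (greedy_family t w) K"
          using wE E by (intro not_available_greedy_family) auto
        then show "(if \<exists>T\<in>S. T \<subseteq> K then ?u w (S \<union> nsets K t) else 0) = 0"
          by (auto simp: uncovered_def available_def)
      qed
    qed (use E in auto)
    also have "\<dots> = (\<Sum>K\<in>?H. ?u w (S \<union> nsets K t))"
      using E(1) by (intro sum.inter_filter[symmetric])
    also have "real (card (E - set w)) = real (card E) - real m"
      using wE m E(1) by (simp add: card_Diff_subset of_nat_diff)
    finally show "(\<Sum>K\<in>E - set w. ?u (w @ [K]) S) =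
        (real (card E) - real m) * ?u w S - (\<Sum>K\<in>?H. ?u w (S \<union> nsets K t))" .
  qed
  also have "\<dots> = (real (card E) - real m) * (\<Sum>w\<in>words E m. ?u w S)
      - (\<Sum>K\<in>?H. \<Sum>w\<in>words E m. ?u w (S \<union> nsets K t))"
    by (simp add: sum_subtractf sum_distrib_left sum.swap[of _ ?H])
  finally have *: "(\<Sum>w\<in>words E (Suc m). ?u w S) = \<dots>" .
  have c: "real (card (words E (Suc m))) = real (card (words E m)) * (real (card E) - real m)"
    using m by (simp add: card_words_Suc[OF E(1)] of_nat_diff)
  have pos: "real (card (words E m)) > 0" "real (card E) - real m > 0"
    using card_words_pos[OF E(1), of m] m by auto
  show ?thesis
    unfolding uncovered_prob_def * c sum_divide_distrib[symmetric]
    using pos by (simp add: field_simps)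
qed

text \<open>The recursion subtracts a nonnegative sum. A bound at an intermediate time thus persists
  to the end of the process.\<close>

lemma uncovered_prob_antimono:
  assumes E: "finite E" "\<And>K. K \<in> E \<Longrightarrow> finite K \<and> t \<le> card K"
    and S: "\<forall>T\<in>S. card T = t" and "m \<le> M" "M \<le> card E"
  shows "uncovered_prob E t M S \<le> uncovered_prob E t m S"
  using assms(4,5)
proof (induction M rule: dec_induct)
  case (step n)
  have "uncovered_prob E t (Suc n) S \<le> uncovered_prob E t n S"
    using step.prems by (subst uncovered_prob_Suc[OF E S])
      (auto intro!: divide_nonneg_nonneg sum_nonneg uncovered_prob_nonneg)
  then show ?case using step by simp
qed simp

subsection \<open>Hierarchies of difference inequalities\<close>

text \<open>Discrete form of integrating \<open>s ^ L\<close> from \<open>0\<close> to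
  \<open>j * h\<close>: the convexity bound \<open>b\<close>, scaled by \<open>h ^ Suc L\<close>,
  makes the sum telescope. Repeated use produces the factorial in \<open>iterate\<close>.\<close>

lemma sum_power_le:
  fixes h :: real assumes "0 \<le> h"
  shows "(\<Sum>i<j. h * (real i * h) ^ L) \<le> (real j * h) ^ Suc L / real (Suc L)"
proof (induction j)
  case (Suc j)
  have b: "real (Suc L) * x ^ L \<le> (x + 1) ^ Suc L - x ^ Suc L" if "0 \<le> x" for x :: real
    using that
  proof (induction L)
    case (Suc L)
    have "x ^ Suc L \<le> (x + 1) ^ Suc L" using that by (intro power_mono) auto
    moreover have "x * (real (Suc L) * x ^ L) \<le> x * ((x + 1) ^ Suc L - x ^ Suc L)"
      using Suc that by (intro mult_left_mono) auto
    ultimately show ?case by (simp add: algebra_simps)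
  qed simp
  have "real (Suc L) * (h * (real j * h) ^ L) = h ^ Suc L * (real (Suc L) * real j ^ L)"
    by (simp add: power_mult_distrib)
  also have "\<dots> \<le> h ^ Suc L * ((real j + 1) ^ Suc L - real j ^ Suc L)"
    using assms by (intro mult_left_mono b) auto
  also have "\<dots> = (real (Suc j) * h) ^ Suc L - (real j * h) ^ Suc L"
    unfolding power_mult_distrib by (simp add: algebra_simps del: power_Suc)
  finally have "h * (real j * h) ^ L \<le> ((real (Suc j) * h) ^ Suc L - (real j * h) ^ Suc L) / real (Suc L)"
    by (simp add: pos_le_divide_eq mult.commute del: power_Suc of_nat_Suc)
  then show ?case using Suc by (simp add: diff_divide_distrib del: power_Suc of_nat_Suc)
qed simp

lemma rising_product_tendsto_0:
  fixes x :: real assumes "0 \<le> x" "real q * x \<le> 1 / 4"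
  shows "(\<lambda>L. (\<Prod>i<L. real n + real i * real q) * x ^ L / fact L) \<longlonglongrightarrow> 0"
proof -
  define f where "f L = (\<Prod>i<L. real n + real i * real q) * x ^ L / fact L" for L
  \<comment> \<open>From \<open>L0\<close> on, \<open>n * x\<close> is at most \<open>L / 4\<close>,
    and so is \<open>L * q * x\<close>; the ratio of consecutive terms is then at most
    \<open>1/2\<close>.\<close>
  obtain L0 :: nat where L0: "4 * (real n * x) \<le> real L0" using real_arch_simple by blast
  have "norm (f (Suc L)) \<le> 1/2 * norm (f L)" if "L0 \<le> L" for L
  proof -
    have nn: "0 \<le> f L" using assms by (auto simp: f_def intro!: mult_nonneg_nonneg divide_nonneg_nonneg prod_nonneg)
    have "(real n + real L * real q) * x / real (Suc L) \<le> 1/2"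
    proof -
      have "real L * (real q * x) \<le> real L * (1/4)" using assms by (intro mult_left_mono) auto
      moreover have "4 * (real n * x) \<le> real L" using L0 that by linarith
      ultimately have "(real n + real L * real q) * x \<le> 1/2 * real (Suc L)" by (simp add: algebra_simps)
      then show ?thesis by (simp add: divide_le_eq)
    qed
    moreover have "f (Suc L) = (real n + real L * real q) * x / real (Suc L) * f L"
      by (simp add: f_def)
    moreover have "0 \<le> (real n + real L * real q) * x / real (Suc L)" using assms by simp
    ultimately have "f (Suc L) \<le> 1/2 * f L" "0 \<le> f (Suc L)"
      using nn by (metis mult_right_mono, metis mult_nonneg_nonneg)
    then show ?thesis using nn by simp
  qed
  then have "summable f" by (intro summable_ratio_test[of "1/2" L0 f]) auto
  then show ?thesis using summable_LIMSEQ_zero unfolding f_def by blast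
qed

text \<open>
  Here \<open>v\<close> is the number of points, \<open>m\<close> the number of steps of size \<open>h v\<close> and \<open>n\<close> the number of
  \<open>t\<close>-sets under consideration.
\<close>

locale hierarchy =
  fixes a :: "nat \<Rightarrow> nat \<Rightarrow> nat \<Rightarrow> real" and h \<delta> :: "nat \<Rightarrow> real" and q :: nat and c :: real
  assumes a_le_1: "\<forall>\<^sub>F v in sequentially. \<forall>m n. real m * h v \<le> c \<longrightarrow> a v m n \<le> 1"
    and a_0: "a v 0 n \<le> 0"
    and h_pos: "\<forall>\<^sub>F v in sequentially. 0 < h v" and h_lim: "h \<longlonglongrightarrow> 0"
    and \<delta>_lim: "\<delta> \<longlonglongrightarrow> 0"
    and step: "\<forall>\<^sub>F v in sequentially. \<forall>m n. real m * h v \<le> c \<longrightarrow>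
      a v (Suc m) n \<le> a v m n + h v * (real n * a v m (n + q) + (real n)\<^sup>2 * \<delta> v)"
begin

text \<open>Uniform in the step \<open>m\<close>, but not in \<open>n\<close>: each later argument
  involves only finitely many values of \<open>n\<close>. The minimum with \<open>c\<close> keeps
  \<open>m\<close> in the range where the locale assumptions apply.\<close>

definition vanish :: "real \<Rightarrow> bool" where
  "vanish r \<longleftrightarrow> (\<forall>n. \<forall>\<epsilon>>0. \<forall>\<^sub>F v in sequentially. \<forall>m. real m * h v \<le> min c r \<longrightarrow> a v m n \<le> \<epsilon>)"

text \<open>The difference inequality is unrolled \<open>L\<close> times from time
  \<open>m * h v\<close>. Each round raises \<open>n\<close> by \<open>q\<close>, contributes one
  factor of the product and one integration of a power of \<open>j * h v\<close>; the innermost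
  round uses the bound \<open>1\<close>.\<close>

lemma iterate:
  assumes r: "vanish r" and \<epsilon>: "0 < \<epsilon>"
  shows "\<forall>\<^sub>F v in sequentially. \<forall>m j. real m * h v \<le> r \<longrightarrow> real (m + j) * h v \<le> c \<longrightarrow> real j * h v \<le> 1 \<longrightarrow>
    a v (m + j) n \<le> \<epsilon> + (\<Prod>i<L. real n + real i * real q) * (real j * h v) ^ L / fact L"
  using \<epsilon>
proof (induction L arbitrary: n \<epsilon>)
  case 0
  from a_le_1 show ?case
  proof eventually_elim
    case (elim v)
    then show ?case using 0 by (auto intro!: add_increasing)
  qed
next
  case (Suc L)
  \<comment> \<open>The budget is split in thirds: value at the start of the interval, error
    inherited from level \<open>n + q\<close>, and the \<open>\<delta>\<close> term. The last two
    are multiplied by \<open>j * h v\<close>, which is at most \<open>1\<close>.\<close>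
  define \<epsilon>' where "\<epsilon>' = \<epsilon> / (3 * (real n + 1))"
  have e': "0 < \<epsilon>'" "real n * \<epsilon>' \<le> \<epsilon> / 3" using Suc.prems by (auto simp: \<epsilon>'_def divide_simps)
  have "((\<lambda>v. (real n)\<^sup>2 * \<delta> v) \<longlonglongrightarrow> (real n)\<^sup>2 * 0)" by (intro tendsto_intros \<delta>_lim)
  then have d: "\<forall>\<^sub>F v in sequentially. (real n)\<^sup>2 * \<delta> v < \<epsilon> / 3"
    using Suc.prems by (intro order_tendstoD) auto
  have r': "\<forall>\<^sub>F v in sequentially. \<forall>m. real m * h v \<le> min c r \<longrightarrow> a v m n \<le> \<epsilon> / 3"
    by (rule r[unfolded vanish_def, rule_format]) (use Suc.prems in simp)
  from Suc.IH[OF e'(1), of "n + q"] d r' step h_pos show ?case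
  proof eventually_elim
    case (elim v)
    let ?p = "(\<Prod>i<L. real (n + q) + real i * real q)"
    show ?case
    proof (intro allI impI)
      fix m j assume mj: "real m * h v \<le> r" "real (m + j) * h v \<le> c" "real j * h v \<le> 1"
      have mono: "real i * h v \<le> real i' * h v" if "i \<le> i'" for i i'
        using that elim(5) by (simp add: mult_right_mono)
      have sum: "a v (m + i) n \<le> a v m n + (\<Sum>i<i. h v * (real n * (\<epsilon>' + ?p * (real i * h v) ^ L / fact L) + \<epsilon> / 3))"
        if "i \<le> j" for i
        using that
      proof (induction i)
        case (Suc i)
        have c: "real (m + i) * h v \<le> c" using mono[of "m + i" "m + j"] Suc.prems mj(2) by simp
        have "real i * h v \<le> 1" using mono[of i j] Suc.prems mj(3) by simp
        then have "a v (m + i) (n + q) \<le> \<epsilon>' + ?p * (real i * h v) ^ L / fact L"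
          using elim(1) c mj(1) by blast
        then have "h v * (real n * a v (m + i) (n + q) + (real n)\<^sup>2 * \<delta> v) \<le>
            h v * (real n * (\<epsilon>' + ?p * (real i * h v) ^ L / fact L) + \<epsilon> / 3)"
          using elim(2,5) by (intro mult_left_mono add_mono) auto
        moreover have "a v (m + Suc i) n \<le> a v (m + i) n + h v * (real n * a v (m + i) (n + q) + (real n)\<^sup>2 * \<delta> v)"
          using elim(4) c by simp
        ultimately show ?case using Suc by simp
      qed simp
      have "real m * h v \<le> min c r" using mj mono[of m "m + j"] by simp
      then have am: "a v m n \<le> \<epsilon> / 3" using elim(3) by blast
      have p0: "0 \<le> real n * ?p / fact L" by (auto intro!: divide_nonneg_nonneg mult_nonneg_nonneg prod_nonneg)
      have "(\<Sum>i<j. h v * (real n * (\<epsilon>' + ?p * (real i * h v) ^ L / fact L) + \<epsilon> / 3)) =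
         (\<Sum>i<j. h v * (real n * \<epsilon>' + \<epsilon> / 3) + real n * ?p / fact L * (h v * (real i * h v) ^ L))"
        by (intro sum.cong) (auto simp: algebra_simps)
      also have "\<dots> = (real j * h v) * (real n * \<epsilon>' + \<epsilon> / 3) + real n * ?p / fact L * (\<Sum>i<j. h v * (real i * h v) ^ L)"
        by (simp add: sum.distrib sum_distrib_left)
      also have "\<dots> \<le> 1 * (\<epsilon> / 3 + \<epsilon> / 3) + real n * ?p / fact L * ((real j * h v) ^ Suc L / real (Suc L))"
        using mj elim(5) e' Suc.prems p0 by (intro add_mono mult_mono mult_left_mono sum_power_le) auto
      \<comment> \<open>The factor \<open>n\<close> becomes the factor of index \<open>0\<close>,
        since \<open>n + q + i * q = n + (i + 1) * q\<close>.\<close>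
      also have "real n * ?p / fact L * ((real j * h v) ^ Suc L / real (Suc L)) =
          (\<Prod>i<Suc L. real n + real i * real q) * (real j * h v) ^ Suc L / fact (Suc L)"
        by (simp add: prod.lessThan_Suc_shift algebra_simps del: prod.lessThan_Suc power_Suc)
      finally show "a v (m + j) n \<le> \<epsilon> + (\<Prod>i<Suc L. real n + real i * real q) * (real j * h v) ^ Suc L / fact (Suc L)"
        using sum[of j] am by simp
    qed
  qed
qed

text \<open>
  The bound of \<open>iterate\<close> tends to zero as \<open>L \<rightarrow> \<infinity>\<close> only when \<open>j h\<close> stays below a constant
  of order \<open>1/q\<close>, which is why the argument advances by time intervals of fixed length.
\<close>

lemma vanish_extend:
  assumes r: "vanish r" "0 \<le> r" and s: "0 < s" "2 * s \<le> 1" "real q * (2 * s) \<le> 1/4"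
  shows "vanish (r + s)"
  unfolding vanish_def
proof (intro allI impI)
  fix n and \<epsilon> :: real assume \<epsilon>: "0 < \<epsilon>"
  have "\<forall>\<^sub>F L in sequentially. (\<Prod>i<L. real n + real i * real q) * (2 * s) ^ L / fact L < \<epsilon> / 2"
    using s \<epsilon> by (intro order_tendstoD(2)[OF rising_product_tendsto_0]) auto
  then obtain L where L: "(\<Prod>i<L. real n + real i * real q) * (2 * s) ^ L / fact L < \<epsilon> / 2"
    by (auto simp: eventually_sequentially)
  have "\<forall>\<^sub>F v in sequentially. h v < s" by (rule order_tendstoD(2)[OF h_lim s(1)])
  moreover have "0 < \<epsilon> / 2" using \<epsilon> by simp
  note iterate[OF r(1) this, of n L]
  ultimately show "\<forall>\<^sub>F v in sequentially. \<forall>m. real m * h v \<le> min c (r + s) \<longrightarrow> a v m n \<le> \<epsilon>"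
    using h_pos
  proof eventually_elim
    case (elim v)
    show ?case
    proof (intro allI impI)
      fix M assume M: "real M * h v \<le> min c (r + s)"
      \<comment> \<open>The last step no later than time \<open>r\<close>, cut off at
        \<open>M\<close>. The remaining time is at most \<open>s + h v\<close>, hence the allowance
        \<open>2 * s\<close>.\<close>
      define m where "m = min M (nat \<lfloor>r / h v\<rfloor>)"
      have "real (nat \<lfloor>r / h v\<rfloor>) \<le> r / h v" using r elim by simp
      then have mr: "real m * h v \<le> r"
        using elim by (simp add: m_def pos_le_divide_eq min_def) (smt (verit, best) mult_right_mono of_nat_le_iff)
      have "real (M - m) * h v \<le> 2 * s"
      proof (cases "m = M")
        case False
        then have m: "m = nat \<lfloor>r / h v\<rfloor>" "m \<le> M" by (auto simp: m_def min_def split: if_splits)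
        have "r / h v < real m + 1" using r elim by (simp add: m(1))
        then have "r < real m * h v + h v" using elim by (simp add: divide_less_eq algebra_simps)
        then show ?thesis using M elim m(2) by (simp add: of_nat_diff algebra_simps)
      qed (use s in simp)
      moreover have mM: "m + (M - m) = M" by (simp add: m_def)
      ultimately have "a v M n \<le> \<epsilon> / 2 + (\<Prod>i<L. real n + real i * real q) * (real (M - m) * h v) ^ L / fact L"
        using elim(2)[rule_format, of m "M - m"] mr M s by simp
      also have "\<dots> \<le> \<epsilon> / 2 + (\<Prod>i<L. real n + real i * real q) * (2 * s) ^ L / fact L"
        using \<open>real (M - m) * h v \<le> 2 * s\<close> elim
        by (intro add_left_mono divide_right_mono mult_left_mono power_mono prod_nonneg) auto
      finally show "a v M n \<le> \<epsilon>" using L by linarith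
    qed
  qed
qed

text \<open>The interval length \<open>s\<close> depends on \<open>q\<close> alone, so finitely many
  extensions reach \<open>c\<close>. They start from \<open>vanish 0\<close>, where positivity of
  \<open>h v\<close> leaves only \<open>m = 0\<close>.\<close>

lemma vanish_all: "vanish c"
proof -
  define s :: real where "s = 1 / (8 * (real q + 1))"
  have s: "0 < s" "2 * s \<le> 1" "real q * (2 * s) \<le> 1/4" by (auto simp: s_def divide_simps)
  have "vanish (real i * s)" for i
  proof (induction i)
    case 0
    have "\<forall>\<^sub>F v in sequentially. \<forall>m. real m * h v \<le> min c 0 \<longrightarrow> a v m n \<le> \<epsilon>" if "0 < \<epsilon>" for n \<epsilon>
      using h_pos
    proof eventually_elim
      case (elim v)
      then show ?case using a_0[of v n] that by (auto simp: mult_le_0_iff)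
    qed
    then show ?case by (simp add: vanish_def)
  next
    case (Suc i)
    then show ?case using vanish_extend[OF Suc _ s] s by (simp add: algebra_simps)
  qed
  moreover obtain i :: nat where i: "c \<le> real i * s"
    using ex_less_of_nat_mult[OF s(1), of c] by (auto intro: less_imp_le)
  ultimately have "vanish (real i * s)" by blast
  then show ?thesis using i unfolding vanish_def by (simp only: min_absorb1 order_refl)
qed

end

subsection \<open>The product approximation\<close>

lemma card_nsets_superset:
  assumes V: "finite V" and R: "R \<subseteq> V" "card R \<le> k"
  shows "card {K\<in>nsets V k. R \<subseteq> K} = (card V - card R) choose (k - card R)"
proof -
  have fR: "finite R" using R V finite_subset by blast
  have "bij_betw (\<lambda>J. J \<union> R) (nsets (V - R) (k - card R)) {K\<in>nsets V k. R \<subseteq> K}"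
  proof (rule bij_betw_byWitness[where f' = "\<lambda>K. K - R"])
    show "(\<lambda>J. J \<union> R) ` nsets (V - R) (k - card R) \<subseteq> {K\<in>nsets V k. R \<subseteq> K}"
    proof (intro image_subsetI)
      fix J assume J: "J \<in> nsets (V - R) (k - card R)"
      then have "card (J \<union> R) = card J + card R"
        using fR by (intro card_Un_disjoint) (auto simp: nsets_def)
      then show "J \<union> R \<in> {K\<in>nsets V k. R \<subseteq> K}" using J R fR by (auto simp: nsets_def)
    qed
    show "(\<lambda>K. K - R) ` {K\<in>nsets V k. R \<subseteq> K} \<subseteq> nsets (V - R) (k - card R)"
      using fR by (auto simp: nsets_def card_Diff_subset)
  qed (auto simp: nsets_def)
  then have "card {K\<in>nsets V k. R \<subseteq> K} = card (nsets (V - R) (k - card R))"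
    by (rule bij_betw_same_card[symmetric])
  then show ?thesis using R fR by (simp add: card_Diff_subset)
qed

text \<open>The lower side is Bernoulli's inequality. The upper side goes by induction: passing from
  \<open>n\<^sup>2\<close> to \<open>(n + 1)\<^sup>2\<close> leaves room for the cross term
  \<open>n * y\<^sup>2\<close>.\<close>

lemma one_minus_power_approx:
  fixes y :: real assumes "0 \<le> y" "y \<le> 1"
  shows "\<bar>(1 - y) ^ n - (1 - real n * y)\<bar> \<le> (real n)\<^sup>2 * y\<^sup>2"
proof -
  have "1 - real n * y \<le> (1 - y) ^ n"
    using Bernoulli_inequality[of "-y" n] assms by simp
  moreover have "(1 - y) ^ n \<le> 1 - real n * y + (real n)\<^sup>2 * y\<^sup>2"
  proof (induction n)
    case (Suc n)
    have "(1 - y) ^ Suc n \<le> (1 - y) * (1 - real n * y + (real n)\<^sup>2 * y\<^sup>2)"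
      using Suc assms by (simp add: mult_left_mono)
    also have "\<dots> = 1 - real (Suc n) * y + (real (Suc n))\<^sup>2 * y\<^sup>2 - (real n + 1) * y\<^sup>2 - (real n)\<^sup>2 * y\<^sup>2 * y"
      by (simp add: power2_eq_square algebra_simps)
    also have "\<dots> \<le> 1 - real (Suc n) * y + (real (Suc n))\<^sup>2 * y\<^sup>2"
    proof -
      have "0 \<le> (real n + 1) * y\<^sup>2" "0 \<le> (real n)\<^sup>2 * y\<^sup>2 * y" using assms by auto
      then show ?thesis by linarith
    qed
    finally show ?case .
  qed simp
  ultimately show ?thesis by simp
qed

text \<open>
  The predicted probability that a given \<open>t\<close>-set is uncovered after \<open>m\<close> of the \<open>e\<close> blocks, if
  distinct \<open>t\<close>-sets behaved independently; \<open>d\<close> is the number of blocks through a \<open>t\<close>-set and \<open>Q\<close>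
  the number of \<open>t\<close>-sets in a block.
\<close>

primrec greedy_curve :: "nat \<Rightarrow> nat \<Rightarrow> nat \<Rightarrow> nat \<Rightarrow> real" where
  "greedy_curve e d Q 0 = 1"
| "greedy_curve e d Q (Suc m) =
     greedy_curve e d Q m - real d / (real e - real m) * greedy_curve e d Q m ^ Q"

text \<open>In the first half of the ordering between \<open>e / 2\<close> and \<open>e\<close>
  blocks remain, so the rate is \<open>d / e\<close> up to a factor \<open>2\<close>.\<close>

lemma step_rate_bounds:
  assumes "2 * m \<le> e" "0 < e"
  shows "real d / real e \<le> real d / (real e - real m)" "real d / (real e - real m) \<le> 2 * real d / real e"
proof -
  have pos: "0 < real e - real m" using assms by linarith
  show "real d / real e \<le> real d / (real e - real m)"
    using pos assms by (intro divide_left_mono) auto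
  have "real d * real e \<le> 2 * real d * (real e - real m)"
    using mult_left_mono[of "real e" "2 * (real e - real m)" "real d"] assms by (simp add: algebra_simps)
  then show "real d / (real e - real m) \<le> 2 * real d / real e"
    using pos assms by (simp add: field_simps)
qed

text \<open>With \<open>2 * d \<le> e\<close> the rate is at most \<open>1\<close>, so a step
  subtracts at most \<open>x ^ Q \<le> x\<close>.\<close>

lemma greedy_curve_bounds:
  assumes "2 * d \<le> e" "0 < e" "1 \<le> Q" "2 * m \<le> e"
  shows "0 \<le> greedy_curve e d Q m \<and> greedy_curve e d Q m \<le> 1"
  using assms(4)
proof (induction m)
  case (Suc m)
  let ?h = "real d / (real e - real m)" and ?f = "greedy_curve e d Q m"
  have f: "0 \<le> ?f" "?f \<le> 1" using Suc by auto
  have "2 * real d / real e \<le> 1" using assms by simp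
  then have h: "0 \<le> ?h" "?h \<le> 1" using step_rate_bounds(2)[of m e d] Suc.prems assms(2) by auto
  have "?f ^ Q \<le> ?f" using f assms(3) power_decreasing[of 1 Q ?f] by simp
  then have "?h * ?f ^ Q \<le> 1 * ?f" using h f by (intro mult_mono) auto
  moreover have "0 \<le> ?h * ?f ^ Q" using h(1) f(1) by (intro mult_nonneg_nonneg zero_le_power)
  ultimately show ?case using f by simp
qed simp

text \<open>The curve is nonincreasing, so each of the first \<open>m\<close> steps removed at least
  \<open>d / e\<close> times the current \<open>Q\<close>-th power; the total removed is
  \<open>1\<close> minus the current value. For large \<open>m * d / e\<close> the curve is
  therefore small.\<close>

lemma greedy_curve_decay:
  assumes "2 * d \<le> e" "0 < e" "1 \<le> Q" "2 * m \<le> e"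
  shows "real m * (real d / real e) * greedy_curve e d Q m ^ Q \<le> 1 - greedy_curve e d Q m"
  using assms(4)
proof (induction m)
  case (Suc m)
  let ?h = "real d / (real e - real m)" and ?f = "greedy_curve e d Q m" and ?r = "real d / real e"
  have f: "0 \<le> ?f" "0 \<le> greedy_curve e d Q (Suc m)"
    using greedy_curve_bounds[OF assms(1-3)] Suc.prems by (auto simp del: greedy_curve.simps)
  have h: "?r \<le> ?h" "0 \<le> ?r" using step_rate_bounds(1)[of m e d] Suc.prems assms by auto
  then have "0 \<le> ?h * ?f ^ Q" using f(1) order.trans by (intro mult_nonneg_nonneg) (blast, simp)
  then have "greedy_curve e d Q (Suc m) \<le> ?f" by simp
  then have "greedy_curve e d Q (Suc m) ^ Q \<le> ?f ^ Q" using f by (intro power_mono)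
  then have "real (Suc m) * ?r * greedy_curve e d Q (Suc m) ^ Q \<le> real (Suc m) * ?r * ?f ^ Q"
    using h by (intro mult_left_mono) auto
  also have "\<dots> = real m * ?r * ?f ^ Q + ?r * ?f ^ Q" by (simp add: algebra_simps add_divide_distrib)
  also have "\<dots> \<le> 1 - ?f + ?h * ?f ^ Q"
    using Suc h f by (intro add_mono mult_right_mono) auto
  finally show ?case by simp
qed simp

text \<open>One step multiplies the curve by \<open>1 - z\<close>, where \<open>z\<close> is the
  rate times the power \<open>Q - 1\<close> of the curve. Linearising \<open>(1 - z) ^ n\<close>
  costs at most \<open>n\<^sup>2 * z\<^sup>2\<close>.\<close>

lemma greedy_curve_power_approx:
  assumes "2 * d \<le> e" "0 < e" "1 \<le> Q" "2 * m \<le> e"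
  shows "\<bar>greedy_curve e d Q (Suc m) ^ n - (greedy_curve e d Q m ^ n -
    real n * real d * greedy_curve e d Q m ^ (n + (Q - 1)) / (real e - real m))\<bar> \<le>
    (real n)\<^sup>2 * (2 * real d / real e)\<^sup>2"
proof -
  define x where "x = greedy_curve e d Q m"
  define z where "z = real d / (real e - real m) * x ^ (Q - 1)"
  have x: "0 \<le> x" "x \<le> 1" using greedy_curve_bounds[OF assms] by (auto simp: x_def)
  have h: "0 \<le> real d / (real e - real m)" "real d / (real e - real m) \<le> 2 * real d / real e"
    "2 * real d / real e \<le> 1"
    using step_rate_bounds[OF assms(4,2), of d] assms by auto
  have "z \<le> 2 * real d / real e * 1"
    unfolding z_def by (intro mult_mono power_le_one) (use x h in auto)
  then have z: "0 \<le> z" "z \<le> 2 * real d / real e" "z \<le> 1"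
    using x(1) h mult_nonneg_nonneg[OF h(1) zero_le_power[OF x(1), of "Q - 1"]]
    unfolding z_def by linarith+
  have "x ^ Q = x * x ^ (Q - 1)" using assms(3) by (simp flip: power_Suc)
  then have Suc: "greedy_curve e d Q (Suc m) = x * (1 - z)" by (simp add: z_def x_def algebra_simps)
  have "greedy_curve e d Q (Suc m) ^ n - (x ^ n - real n * (x ^ n * z)) =
      x ^ n * ((1 - z) ^ n - (1 - real n * z))"
    unfolding Suc power_mult_distrib by (simp add: algebra_simps)
  moreover have "\<bar>x ^ n * ((1 - z) ^ n - (1 - real n * z))\<bar> \<le> 1 * ((real n)\<^sup>2 * z\<^sup>2)"
    unfolding abs_mult using x z
    by (intro mult_mono one_minus_power_approx) (auto simp: power_le_one)
  moreover have "(real n)\<^sup>2 * z\<^sup>2 \<le> (real n)\<^sup>2 * (2 * real d / real e)\<^sup>2"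
    using z by (intro mult_left_mono power_mono) auto
  moreover have "real n * (x ^ n * z) = real n * real d * x ^ (n + (Q - 1)) / (real e - real m)"
    by (simp add: z_def power_add)
  ultimately show ?thesis unfolding x_def by linarith
qed

section \<open>Block counts and the error of the product approximation\<close>

locale design_parameters =
  fixes V :: "'a set" and k t :: nat
  assumes V: "finite V" and t: "t < k" and k: "k \<le> card V"
begin

abbreviation "E \<equiv> nsets V k"
abbreviation "Q \<equiv> k choose t"
abbreviation "d \<equiv> (card V - t) choose (k - t)"
abbreviation "\<kappa> \<equiv> (card V - Suc t) choose (k - Suc t)"
abbreviation "P \<equiv> uncovered_prob E t"
abbreviation "f \<equiv> greedy_curve (card E) d Q"

lemma finite_E: "finite E" using V by (rule finite_imp_finite_nsets)

lemma E_blocks: "K \<in> E \<Longrightarrow> finite K \<and> t \<le> card K"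
  using t by (auto simp: nsets_def)

lemma E_pos: "0 < card E"
  using k by (simp add: zero_less_binomial)

lemma d_pos: "0 < d" using k by (simp add: zero_less_binomial)

lemma Q_pos: "1 \<le> Q" using t by (simp add: Suc_le_eq zero_less_binomial)

lemma degree: "T \<in> nsets V t \<Longrightarrow> card {K\<in>E. T \<subseteq> K} = d"
  using card_nsets_superset[OF V, of T k] t by (auto simp: nsets_def)

text \<open>Two distinct \<open>t\<close>-sets together have at least \<open>t + 1\<close> points,
  so every block through both contains a fixed set of \<open>t + 1\<close> points.\<close>

lemma codegree:
  assumes "T \<in> nsets V t" "T' \<in> nsets V t" "T \<noteq> T'"
  shows "card {K\<in>E. T \<subseteq> K \<and> T' \<subseteq> K} \<le> \<kappa>"
proof -
  have fin: "finite T" "finite T'" "card T = t" "card T' = t" "T \<subseteq> V" "T' \<subseteq> V"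
    using assms by (auto simp: nsets_def)
  then have "\<not> T' \<subseteq> T" using assms(3) card_subset_eq[of T T'] by auto
  then obtain x where x: "x \<in> T'" "x \<notin> T" by blast
  have "card {K\<in>E. T \<subseteq> K \<and> T' \<subseteq> K} \<le> card {K\<in>E. insert x T \<subseteq> K}"
    using x finite_E by (intro card_mono) auto
  also have "\<dots> = \<kappa>"
    using card_nsets_superset[OF V, of "insert x T" k] fin x t by (auto simp: Suc_le_eq)
  finally show ?thesis .
qed

definition hit :: "'a set set \<Rightarrow> 'a set set" where
  "hit S = {K\<in>E. \<exists>T\<in>S. T \<subseteq> K}"

definition multiply_hit :: "'a set set \<Rightarrow> 'a set set" where
  "multiply_hit S = {K\<in>E. \<exists>T\<in>S. \<exists>T'\<in>S. T \<noteq> T' \<and> T \<subseteq> K \<and> T' \<subseteq> K}"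

lemma finite_S: "S \<subseteq> nsets V t \<Longrightarrow> finite S"
  using V finite_imp_finite_nsets finite_subset by blast

text \<open>Adding \<open>T\<close> to \<open>S\<close> brings \<open>d\<close> blocks, of which at
  most \<open>card S * \<kappa>\<close> were counted before.\<close>

lemma card_hit:
  assumes "S \<subseteq> nsets V t"
  shows "real (card (hit S)) \<le> real (card S) * real d \<and>
    real (card S) * real d - (real (card S))\<^sup>2 * real \<kappa> \<le> real (card (hit S))"
  using finite_S[OF assms] assms
proof (induction S rule: finite_induct)
  case empty
  then show ?case by (simp add: hit_def)
next
  case (insert T S)
  let ?ET = "{K\<in>E. T \<subseteq> K}"
  have eq: "hit (insert T S) = hit S \<union> ?ET" by (auto simp: hit_def)
  have fin: "finite (hit S)" "finite ?ET" using finite_E by (auto simp: hit_def)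
  have d: "card ?ET = d" using insert.prems by (intro degree) auto
  have "hit S \<inter> ?ET = (\<Union>T'\<in>S. {K\<in>E. T \<subseteq> K \<and> T' \<subseteq> K})" by (auto simp: hit_def)
  then have "card (hit S \<inter> ?ET) \<le> (\<Sum>T'\<in>S. card {K\<in>E. T \<subseteq> K \<and> T' \<subseteq> K})"
    using card_UN_le[OF insert.hyps(1), of "\<lambda>T'. {K\<in>E. T \<subseteq> K \<and> T' \<subseteq> K}"] by (simp only:)
  also have "\<dots> \<le> (\<Sum>T'\<in>S. \<kappa>)"
    using insert.prems insert.hyps by (intro sum_mono codegree) auto
  finally have int: "card (hit S \<inter> ?ET) \<le> card S * \<kappa>" by simp
  then have "real (card (hit S \<inter> ?ET)) \<le> real (card S) * real \<kappa>"
    by (simp flip: of_nat_mult)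
  moreover have "card (hit S) + card ?ET = card (hit (insert T S)) + card (hit S \<inter> ?ET)"
    unfolding eq by (rule card_Un_Int) (use fin in auto)
  then have "real (card (hit S)) + real d = real (card (hit (insert T S))) + real (card (hit S \<inter> ?ET))"
    unfolding d by (simp flip: of_nat_add)
  moreover have "0 \<le> (real (card S) + 1) * real \<kappa>" by simp
  ultimately show ?case using insert by (simp add: power2_eq_square algebra_simps)
qed

lemma card_multiply_hit:
  assumes S: "S \<subseteq> nsets V t"
  shows "card (multiply_hit S) \<le> (card S)\<^sup>2 * \<kappa>"
proof -
  have fin: "finite S" using S by (rule finite_S)
  let ?I = "{(T, T') \<in> S \<times> S. T \<noteq> T'}"
  have "multiply_hit S = (\<Union>(T, T')\<in>?I. {K\<in>E. T \<subseteq> K \<and> T' \<subseteq> K})"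
    by (auto simp: multiply_hit_def)
  moreover have I: "finite ?I" by (rule finite_subset[of _ "S \<times> S"]) (use fin in auto)
  ultimately have "card (multiply_hit S) \<le> (\<Sum>(T, T')\<in>?I. card {K\<in>E. T \<subseteq> K \<and> T' \<subseteq> K})"
    using card_UN_le[OF I, of "\<lambda>(T, T'). {K\<in>E. T \<subseteq> K \<and> T' \<subseteq> K}"] by (simp add: case_prod_unfold)
  also have "\<dots> \<le> (\<Sum>_\<in>?I. \<kappa>)"
    using S by (intro sum_mono) (auto intro!: codegree)
  also have "\<dots> \<le> (card S)\<^sup>2 * \<kappa>"
    using card_mono[of "S \<times> S" ?I] fin by (auto simp: power2_eq_square card_cartesian_product)
  finally show ?thesis .
qed

text \<open>Exactly one of the \<open>Q\<close> \<open>t\<close>-sets of \<open>K\<close> already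
  lies in \<open>S\<close>. This is the origin of the shift \<open>q = Q - 1\<close> in the
  hierarchy.\<close>

lemma card_simply_hit:
  assumes S: "S \<subseteq> nsets V t" and K: "K \<in> hit S - multiply_hit S"
  shows "card (S \<union> nsets K t) = card S + (Q - 1)"
proof -
  obtain T where T: "T \<in> S" "T \<subseteq> K" using K by (auto simp: hit_def)
  have KE: "K \<in> E" "finite K" "card K = k" using K by (auto simp: hit_def nsets_def)
  have "S \<inter> nsets K t = {T}"
    using T S K KE by (auto simp: multiply_hit_def nsets_def)
  then have "card S + card (nsets K t) = card (S \<union> nsets K t) + 1"
    using card_Un_Int[of S "nsets K t"] finite_S[OF S] finite_imp_finite_nsets[OF KE(2)] by simp
  moreover have "card (nsets K t) = Q" using KE by (simp)
  ultimately show ?thesis using Q_pos by simp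
qed

text \<open>Simply hit blocks cost at most \<open>a\<close> each, multiply hit ones at most
  \<open>1\<close> each. Replacing \<open>card (hit S)\<close> by \<open>card S * d\<close> costs
  another \<open>\<kappa>\<close> term, hence the factor \<open>2\<close>.\<close>

lemma sum_hit_approx:
  assumes S: "S \<subseteq> nsets V t" and \<psi>: "0 \<le> \<psi>" "\<psi> \<le> 1"
    and a: "\<And>S'. S' \<subseteq> nsets V t \<Longrightarrow> card S' = card S + (Q - 1) \<Longrightarrow> \<bar>P m S' - \<psi>\<bar> \<le> a" and "0 \<le> a"
  shows "\<bar>(\<Sum>K\<in>hit S. P m (S \<union> nsets K t)) - real (card S) * real d * \<psi>\<bar> \<le>
    real (card S) * real d * a + 2 * (real (card S))\<^sup>2 * real \<kappa>"
proof -
  let ?g = "\<lambda>K. P m (S \<union> nsets K t) - \<psi>"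
  have fin: "finite (hit S)" "multiply_hit S \<subseteq> hit S"
    using finite_E by (auto simp: hit_def multiply_hit_def)
  have KV: "nsets K t \<subseteq> nsets V t" if "K \<in> hit S" for K
    using that by (auto simp: hit_def nsets_def)
  have split: "(\<Sum>K\<in>hit S. P m (S \<union> nsets K t)) =
      (\<Sum>K\<in>hit S - multiply_hit S. ?g K) + (\<Sum>K\<in>multiply_hit S. ?g K) + real (card (hit S)) * \<psi>"
    using sum.subset_diff[OF fin(2,1), of ?g] by (simp add: sum_subtractf)
  have "\<bar>\<Sum>K\<in>hit S - multiply_hit S. ?g K\<bar> \<le> (\<Sum>K\<in>hit S - multiply_hit S. a)"
    using S KV card_simply_hit[OF S] by (intro order.trans[OF sum_abs] sum_mono a) auto
  also have "\<dots> \<le> real (card (hit S)) * a"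
    using fin card_mono[of "hit S" "hit S - multiply_hit S"] \<open>0 \<le> a\<close> by (auto intro!: mult_right_mono)
  also have "\<dots> \<le> real (card S) * real d * a"
    using card_hit[OF S] \<open>0 \<le> a\<close> by (intro mult_right_mono) auto
  finally have 1: "\<bar>\<Sum>K\<in>hit S - multiply_hit S. ?g K\<bar> \<le> real (card S) * real d * a" .
  have g1: "\<bar>P m S' - \<psi>\<bar> \<le> 1" for S'
    using uncovered_prob_nonneg[of E t m S'] uncovered_prob_le_1[of E t m S'] \<psi> by linarith
  have "\<bar>\<Sum>K\<in>multiply_hit S. ?g K\<bar> \<le> (\<Sum>K\<in>multiply_hit S. 1)"
    by (intro order.trans[OF sum_abs] sum_mono g1)
  also have "\<dots> \<le> (real (card S))\<^sup>2 * real \<kappa>"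
    using card_multiply_hit[OF S] by (simp flip: of_nat_mult of_nat_power)
  finally have 2: "\<bar>\<Sum>K\<in>multiply_hit S. ?g K\<bar> \<le> (real (card S))\<^sup>2 * real \<kappa>" .
  have "\<bar>real (card (hit S)) * \<psi> - real (card S) * real d * \<psi>\<bar> =
      \<bar>real (card (hit S)) - real (card S) * real d\<bar> * \<psi>"
    using \<psi> by (simp add: abs_mult flip: left_diff_distrib)
  also have "\<dots> \<le> ((real (card S))\<^sup>2 * real \<kappa>) * 1"
    using card_hit[OF S] \<psi> by (intro mult_mono) auto
  finally have 3: "\<bar>real (card (hit S)) * \<psi> - real (card S) * real d * \<psi>\<bar> \<le> (real (card S))\<^sup>2 * real \<kappa>"
    by simp
  show ?thesis using 1 2 3 unfolding split by linarith
qed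

text \<open>The inserted \<open>0\<close> covers the case that \<open>V\<close> has fewer than \<open>n\<close> \<open>t\<close>-sets.\<close>

definition err :: "nat \<Rightarrow> nat \<Rightarrow> real" where
  "err m n = Max (insert 0 ((\<lambda>S. \<bar>P m S - f m ^ n\<bar>) ` {S. S \<subseteq> nsets V t \<and> card S = n}))"

lemma finite_err_domain: "finite {S. S \<subseteq> nsets V t \<and> card S = n}"
  using finite_imp_finite_nsets[OF V, of t] by simp

lemma err_ge: "S \<subseteq> nsets V t \<Longrightarrow> card S = n \<Longrightarrow> \<bar>P m S - f m ^ n\<bar> \<le> err m n"
  unfolding err_def by (intro Max_ge) (use finite_err_domain in auto)

lemma err_nonneg: "0 \<le> err m n"
  unfolding err_def by (intro Max_ge) (use finite_err_domain in auto)

lemma err_le: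
  assumes "\<And>S. S \<subseteq> nsets V t \<Longrightarrow> card S = n \<Longrightarrow> \<bar>P m S - f m ^ n\<bar> \<le> b" "0 \<le> b"
  shows "err m n \<le> b"
  unfolding err_def by (intro Max.boundedI) (use assms finite_err_domain in auto)

lemma err_0: "err 0 n \<le> 0"
  by (intro err_le) auto

context
  assumes d_le: "2 * d \<le> card E"
begin

lemma err_le_1: "2 * m \<le> card E \<Longrightarrow> err m n \<le> 1"
proof (rule err_le)
  fix S assume "2 * m \<le> card E"
  then have "0 \<le> f m ^ n" "f m ^ n \<le> 1"
    using greedy_curve_bounds[OF d_le E_pos Q_pos] by (auto simp: power_le_one)
  then show "\<bar>P m S - f m ^ n\<bar> \<le> 1"
    using uncovered_prob_nonneg[of E t m S] uncovered_prob_le_1[of E t m S] by linarith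
qed simp

text \<open>The recursions for \<open>P\<close> and for the powers of the curve are subtracted. The
  sum over hit blocks yields the error at level \<open>n + (Q - 1)\<close> and the term with
  \<open>\<kappa> / d\<close>; linearising the power yields \<open>h\<^sup>2\<close>. This is the
  \<open>step\<close> inequality of \<open>hierarchy\<close>.\<close>

lemma err_step:
  fixes m n :: nat
  defines "h \<equiv> 2 * real d / real (card E)"
  assumes m: "2 * m \<le> card E"
  shows "err (Suc m) n \<le>
    err m n + h * (real n * err m (n + (Q - 1)) + (real n)\<^sup>2 * (2 * real \<kappa> / real d + h))"
proof (rule err_le)
  let ?r = "real (card E) - real m"
  define y where "y = real d / ?r"
  have r: "0 < ?r" using m E_pos by linarith
  have y: "0 \<le> y" "y \<le> h" "h \<le> 1" "0 \<le> h"
    using step_rate_bounds[OF m E_pos, of d] r d_le E_pos by (auto simp: y_def h_def)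
  have f: "0 \<le> f m" "f m \<le> 1" using greedy_curve_bounds[OF d_le E_pos Q_pos m] by auto
  have fp: "0 \<le> f m ^ i" "f m ^ i \<le> 1" for i using f by (auto simp: power_le_one)
  have bound_nonneg: "0 \<le> h * (real n * err m (n + (Q - 1)) + (real n)\<^sup>2 * (2 * real \<kappa> / real d + h))"
    using y(4) by (auto intro!: mult_nonneg_nonneg add_nonneg_nonneg err_nonneg)
  then show "0 \<le> err m n + h * (real n * err m (n + (Q - 1)) + (real n)\<^sup>2 * (2 * real \<kappa> / real d + h))"
    using err_nonneg[of m n] by linarith
  fix S assume S: "S \<subseteq> nsets V t" "card S = n"
  define X where "X = (\<Sum>K\<in>hit S. P m (S \<union> nsets K t))"
  have St: "\<forall>T\<in>S. card T = t" using S(1) by (auto simp: nsets_def)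
  have mE: "m < card E" using r by linarith
  have P: "P (Suc m) S = P m S - X / ?r"
    unfolding X_def hit_def
    by (rule uncovered_prob_Suc[OF finite_E E_blocks St mE])
  have curve: "\<bar>f (Suc m) ^ n - (f m ^ n - real n * real d * f m ^ (n + (Q - 1)) / ?r)\<bar> \<le> (real n)\<^sup>2 * h\<^sup>2"
    unfolding h_def by (rule greedy_curve_power_approx[OF d_le E_pos Q_pos m])
  have factor: "(N * D * a + 2 * N\<^sup>2 * b) / s = D / s * (N * a + N\<^sup>2 * (2 * b / D))" if "0 < D" for N D a b s :: real
    using that by (cases "s = 0") (simp_all add: field_simps)
  have regroup: "h * (N * a + N\<^sup>2 * b) + N\<^sup>2 * h\<^sup>2 = h * (N * a + N\<^sup>2 * (b + h))" for N a b :: real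
    by (simp add: power2_eq_square algebra_simps)
  have "\<bar>X - real n * real d * f m ^ (n + (Q - 1))\<bar> \<le>
      real n * real d * err m (n + (Q - 1)) + 2 * (real n)\<^sup>2 * real \<kappa>"
    unfolding X_def S(2)[symmetric]
    by (rule sum_hit_approx[OF S(1) fp err_ge err_nonneg])
  then have "\<bar>X - real n * real d * f m ^ (n + (Q - 1))\<bar> / ?r \<le>
      (real n * real d * err m (n + (Q - 1)) + 2 * (real n)\<^sup>2 * real \<kappa>) / ?r"
    using r by (intro divide_right_mono) auto
  also have "\<dots> = y * (real n * err m (n + (Q - 1)) + (real n)\<^sup>2 * (2 * real \<kappa> / real d))"
    unfolding y_def by (rule factor) (use d_pos in linarith)
  also have "\<dots> \<le> h * (real n * err m (n + (Q - 1)) + (real n)\<^sup>2 * (2 * real \<kappa> / real d))"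
    using y by (intro mult_right_mono) (auto intro!: mult_nonneg_nonneg add_nonneg_nonneg err_nonneg)
  finally have "\<bar>(X - real n * real d * f m ^ (n + (Q - 1))) / ?r\<bar> \<le> \<dots>"
    using r by (simp add: abs_divide)
  moreover have "P (Suc m) S - f (Suc m) ^ n =
    (P m S - f m ^ n) - (X - real n * real d * f m ^ (n + (Q - 1))) / ?r -
    (f (Suc m) ^ n - (f m ^ n - real n * real d * f m ^ (n + (Q - 1)) / ?r))"
    unfolding P diff_divide_distrib by linarith
  moreover have triangle: "\<bar>a - b - c\<bar> \<le> a' + b' + c'" if "\<bar>a\<bar> \<le> a'" "\<bar>b\<bar> \<le> b'" "\<bar>c\<bar> \<le> c'"
    for a b c a' b' c' :: real
    using that by linarith
  ultimately have "\<bar>P (Suc m) S - f (Suc m) ^ n\<bar> \<le> err m n +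
     h * (real n * err m (n + (Q - 1)) + (real n)\<^sup>2 * (2 * real \<kappa> / real d)) + (real n)\<^sup>2 * h\<^sup>2"
    using triangle[OF err_ge[OF S, of m] _ curve] by metis
  then show "\<bar>P (Suc m) S - f (Suc m) ^ n\<bar> \<le>
    err m n + h * (real n * err m (n + (Q - 1)) + (real n)\<^sup>2 * (2 * real \<kappa> / real d + h))"
    unfolding add.assoc regroup .
qed

end

text \<open>Both sides count pairs of a block and a \<open>t\<close>-set in it. Consequently
  \<open>d / card E\<close> tends to \<open>0\<close> for \<open>t \<ge> 1\<close>.\<close>

lemma card_E_mult: "(card V choose t) * d = card E * Q"
  unfolding card_nsets using t k by (intro choose_mult[symmetric]) auto

text \<open>Both sides count blocks through a fixed \<open>t\<close>-set with one further point
  marked; so \<open>\<kappa> / d\<close> is of order \<open>1 / card V\<close>.\<close>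

lemma d_mult: "(k - t) * d = (card V - t) * \<kappa>"
proof -
  have "Suc (k - Suc t) = k - t" "card V - t - 1 = card V - Suc t" using t by auto
  then show ?thesis using binomial_absorption[of "k - Suc t" "card V - t"] by metis
qed

end

subsection \<open>Asymptotics and expected density\<close>

lemma filterlim_choose_at_top:
  assumes "1 \<le> s" shows "filterlim (\<lambda>n. real (n choose s)) at_top sequentially"
proof (rule filterlim_at_top_mono)
  have "filterlim (\<lambda>n. real n * (1 / real s)) at_top sequentially"
    using assms by (intro filterlim_at_top_mult_tendsto_pos[OF tendsto_const] filterlim_real_sequentially) auto
  then show "filterlim (\<lambda>n. real n / real s) at_top sequentially" by simp
  show "\<forall>\<^sub>F n in sequentially. real n / real s \<le> real (n choose s)"
    using eventually_ge_at_top[of s]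
  proof eventually_elim
    case (elim n)
    have "(real n / real s) ^ 1 \<le> (real n / real s) ^ s"
      using assms elim by (intro power_increasing) auto
    also have "\<dots> \<le> real (n choose s)" using binomial_ge_n_over_k_pow_k[OF elim, where ?'a = real] by simp
    finally show ?case by simp
  qed
qed

text \<open>At a time \<open>c\<close> depending only on \<open>\<epsilon>\<close> and
  \<open>Q\<close> the curve is below \<open>\<epsilon> / 2\<close>, and by the hierarchy so is the
  error for single \<open>t\<close>-sets. Monotonicity carries the bound to the end.\<close>

lemma uncovered_prob_vanishes:
  assumes t: "1 \<le> t" "t < k" and \<epsilon>: "0 < \<epsilon>"
  shows "\<forall>\<^sub>F v in sequentially. \<forall>T\<in>nsets {..<v} t.
    uncovered_prob (nsets {..<v} k) t (card (nsets {..<v} k)) {T} \<le> \<epsilon>"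
proof -
  define Q where "Q = k choose t"
  define d where "d v = (v - t) choose (k - t)" for v
  define \<kappa> where "\<kappa> v = (v - Suc t) choose (k - Suc t)" for v
  define h where "h v = 2 * real (d v) / real (v choose k)" for v
  define \<delta> where "\<delta> v = 2 * real (\<kappa> v) / real (d v) + h v" for v
  \<comment> \<open>The default \<open>0\<close> makes \<open>a v 0 n \<le> 0\<close> hold for every
    \<open>v\<close>, also where no block exists.\<close>
  define a where "a v m n = (if k \<le> v then design_parameters.err {..<v} k t m n else 0)" for v m n
  \<comment> \<open>Step \<open>m\<close> below has \<open>m * h v \<ge> c / 2\<close>, and the
    decay bound gives \<open>(m * h v) * x ^ Q \<le> 2\<close>; together
    \<open>x ^ Q \<le> 4 / c\<close>.\<close>
  define c where "c = 4 / (\<epsilon> / 2) ^ Q"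
  have c: "0 < c" using \<epsilon> by (simp add: c_def)
  have dp: "design_parameters {..<v} k t" if "k \<le> v" for v
    using that t by unfold_locales auto
  have Q: "1 \<le> Q" using t by (simp add: Q_def Suc_le_eq zero_less_binomial)
  have ev_k: "\<forall>\<^sub>F v in sequentially. k \<le> v" by (rule eventually_ge_at_top)
  have d_pos: "0 < d v" and e_pos: "0 < v choose k" if "k \<le> v" for v
    using that t by (auto simp: d_def zero_less_binomial)
  have "\<forall>\<^sub>F v in sequentially. 2 * real Q / real (v choose t) = h v"
    using ev_k
  proof eventually_elim
    case (elim v)
    have "(v choose t) * d v = (v choose k) * Q"
      using design_parameters.card_E_mult[OF dp[OF elim]] by (simp add: d_def Q_def)
    then have "real (v choose t) * real (d v) = real (v choose k) * real Q" by (simp flip: of_nat_mult)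
    moreover have "0 < v choose t" using elim t by (simp add: zero_less_binomial)
    ultimately show ?case using e_pos[OF elim] by (simp add: h_def field_simps)
  qed
  moreover have "(\<lambda>v. 2 * real Q / real (v choose t)) \<longlonglongrightarrow> 0"
    by (rule tendsto_divide_0[OF tendsto_const filterlim_at_top_imp_at_infinity[OF filterlim_choose_at_top[OF t(1)]]])
  ultimately have h_lim: "h \<longlonglongrightarrow> 0" by (rule Lim_transform_eventually[rotated])
  have shift: "filterlim (\<lambda>v. v - t) sequentially sequentially" by (rule filterlim_minus_const_nat_at_top)
  have "\<forall>\<^sub>F v in sequentially. 2 * real (k - t) / real (v - t) = 2 * real (\<kappa> v) / real (d v)"
    using ev_k
  proof eventually_elim
    case (elim v)
    have "(k - t) * d v = (v - t) * \<kappa> v"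
      using design_parameters.d_mult[OF dp[OF elim]] by (simp add: d_def \<kappa>_def)
    then have "real (k - t) * real (d v) = real (v - t) * real (\<kappa> v)" by (simp flip: of_nat_mult)
    then show ?case using d_pos[OF elim] t elim by (simp add: field_simps)
  qed
  moreover have "(\<lambda>v. 2 * real (k - t) / real (v - t)) \<longlonglongrightarrow> 0"
    by (rule tendsto_divide_0[OF tendsto_const filterlim_at_top_imp_at_infinity
        [OF filterlim_compose[OF filterlim_real_sequentially shift]]])
  ultimately have "(\<lambda>v. 2 * real (\<kappa> v) / real (d v)) \<longlonglongrightarrow> 0" by (rule Lim_transform_eventually[rotated])
  from tendsto_add[OF this h_lim] have \<delta>_lim: "\<delta> \<longlonglongrightarrow> 0" by (simp add: \<delta>_def[abs_def])
  have "filterlim (\<lambda>v. real (d v)) at_top sequentially"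
    unfolding d_def using t by (intro filterlim_compose[OF filterlim_choose_at_top shift]) auto
  then have ev_d: "\<forall>\<^sub>F v in sequentially. c \<le> real (d v)" by (simp add: filterlim_at_top)
  have ev_h: "\<forall>\<^sub>F v in sequentially. h v < min 1 (c / 2)"
    by (rule order_tendstoD(2)[OF h_lim]) (use c in auto)
  \<comment> \<open>As \<open>d v\<close> exceeds \<open>c\<close> for large \<open>v\<close>, time
    \<open>c\<close> falls in the first half of the ordering.\<close>
  have early: "2 * m \<le> v choose k" if "k \<le> v" "c \<le> real (d v)" "real m * h v \<le> c" for v m
  proof -
    have e: "0 < real (v choose k)" and d: "0 < real (d v)" using e_pos d_pos that by auto
    have "real m * h v = (2 * real m) * real (d v) / real (v choose k)" by (simp add: h_def)
    then have "(2 * real m) * real (d v) \<le> c * real (v choose k)"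
      using that e by (simp add: pos_divide_le_eq)
    also have "\<dots> \<le> real (d v) * real (v choose k)" using that e by (intro mult_right_mono) auto
    finally have "(2 * real m) * real (d v) \<le> real (d v) * real (v choose k)" .
    then have "2 * real m \<le> real (v choose k)" using d by simp
    then show ?thesis by linarith
  qed
  have d_le: "2 * d v \<le> v choose k" if "k \<le> v" "h v < 1" for v
  proof -
    have "2 * real (d v) \<le> real (v choose k)"
      using that e_pos[OF that(1)] by (simp add: h_def divide_less_eq)
    then show ?thesis by linarith
  qed
  interpret hierarchy a h \<delta> "Q - 1" c
  proof
    show "\<forall>\<^sub>F v in sequentially. \<forall>m n. real m * h v \<le> c \<longrightarrow> a v m n \<le> 1"
      using ev_k ev_d ev_h
    proof eventually_elim
      case (elim v)
      show ?case using design_parameters.err_le_1[OF dp[OF elim(1)]] early[OF elim(1,2)] d_le[OF elim(1)] elim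
        by (auto simp: a_def d_def)
    qed
    show "a v 0 n \<le> 0" for v n
      using design_parameters.err_0[OF dp] by (simp add: a_def)
    show "\<forall>\<^sub>F v in sequentially. 0 < h v"
      using ev_k by eventually_elim (simp add: h_def d_pos e_pos)
    show "h \<longlonglongrightarrow> 0" by fact
    show "\<delta> \<longlonglongrightarrow> 0" by fact
    show "\<forall>\<^sub>F v in sequentially. \<forall>m n. real m * h v \<le> c \<longrightarrow>
      a v (Suc m) n \<le> a v m n + h v * (real n * a v m (n + (Q - 1)) + (real n)\<^sup>2 * \<delta> v)"
      using ev_k ev_d ev_h
    proof eventually_elim
      case (elim v)
      have "a v (Suc m) n \<le> a v m n + h v * (real n * a v m (n + (Q - 1)) + (real n)\<^sup>2 * \<delta> v)"
        if "real m * h v \<le> c" for m n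
        using design_parameters.err_step[OF dp[OF elim(1)], of m n]
          early[OF elim(1,2) that] d_le[OF elim(1)] elim
        unfolding a_def \<delta>_def h_def d_def \<kappa>_def Q_def card_nsets card_lessThan by simp
      then show ?case by blast
    qed
  qed
  have "\<forall>\<^sub>F v in sequentially. \<forall>m. real m * h v \<le> c \<longrightarrow> a v m 1 \<le> \<epsilon> / 2"
    using vanish_all[unfolded vanish_def, rule_format, of "\<epsilon> / 2" 1] \<epsilon> by (simp only: min.idem half_gt_zero)
  then show ?thesis using h_pos ev_k ev_d ev_h
  proof eventually_elim
    case (elim v)
    interpret design_parameters "{..<v}" k t by (rule dp) fact
    \<comment> \<open>The last step up to time \<open>c\<close>; since \<open>h v < c / 2\<close>,
      its time is beyond \<open>c / 2\<close>.\<close>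
    define m where "m = nat \<lfloor>c / h v\<rfloor>"
    have "real m \<le> c / h v" "c / h v < real m + 1" using elim c by (auto simp: m_def)
    then have mh: "real m * h v \<le> c" "c < real m * h v + h v"
      using elim by (simp_all add: pos_le_divide_eq pos_divide_less_eq algebra_simps)
    have m: "2 * m \<le> v choose k" using early mh elim by blast
    have dle: "2 * d v \<le> v choose k" using d_le elim by auto
    define x where "x = greedy_curve (v choose k) (d v) Q m"
    have x: "0 \<le> x" using greedy_curve_bounds[OF dle e_pos Q m] elim by (simp add: x_def)
    have "real m * (real (d v) / real (v choose k)) * x ^ Q \<le> 1 - x"
      unfolding x_def using greedy_curve_decay[OF dle e_pos Q m] elim by simp
    moreover have "real (d v) / real (v choose k) = h v / 2" by (simp add: h_def)
    ultimately have "(real m * h v) * x ^ Q \<le> 2" using x by simp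
    moreover have "(c / 2) * x ^ Q \<le> (real m * h v) * x ^ Q"
      using mh elim x by (intro mult_right_mono) auto
    ultimately have "c * x ^ Q \<le> 4" by simp
    then have "x ^ Q \<le> 4 / c" using c by (simp only: pos_le_divide_eq mult.commute)
    also have "4 / c = (\<epsilon> / 2) ^ Q" by (simp add: c_def)
    finally have "x \<le> \<epsilon> / 2"
      using power_strict_mono[of "\<epsilon> / 2" x Q] \<epsilon> Q by (cases "x \<le> \<epsilon> / 2") auto
    moreover have "err m 1 \<le> \<epsilon> / 2" using elim mh by (simp add: a_def)
    moreover have "uncovered_prob (nsets {..<v} k) t m {T} \<le> x + err m 1" if "T \<in> nsets {..<v} t" for T
    proof -
      have "\<bar>uncovered_prob (nsets {..<v} k) t m {T} - x\<bar> \<le> err m 1"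
        using err_ge[of "{T}" 1 m] that by (simp add: x_def d_def Q_def)
      then show ?thesis by linarith
    qed
    moreover have "uncovered_prob (nsets {..<v} k) t (card (nsets {..<v} k)) {T} \<le>
        uncovered_prob (nsets {..<v} k) t m {T}" if "T \<in> nsets {..<v} t" for T
      by (rule uncovered_prob_antimono[OF finite_E E_blocks])
        (use that m in \<open>auto simp: nsets_def card_nsets[unfolded nsets_def]\<close>)
    ultimately show ?case by (smt (verit, best) field_sum_of_halves)
  qed
qed

text \<open>For \<open>t = k\<close> every \<open>t\<close>-set is itself an inspected block. This
  case stands apart because the degree \<open>d\<close> is then \<open>1\<close> and does not
  grow.\<close>

lemma uncovered_prob_singleton_blocks:
  assumes V: "finite V" and T: "T \<in> nsets V t"
  shows "uncovered_prob (nsets V t) t (card (nsets V t)) {T} = 0"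
proof -
  have "\<not> uncovered (greedy_family t w) {T}" if "w \<in> words (nsets V t) (card (nsets V t))" for w
  proof -
    have "set w = nsets V t"
      using that words_card_eq_permutations[OF finite_imp_finite_nsets[OF V]]
      by (auto simp: permutations_of_set_def)
    then have "\<not> available t (greedy_family t w) T"
      using T by (intro not_available_greedy_family) (auto simp: nsets_def)
    moreover have "nsets T t = {T}" using T card_subset_eq by (auto simp: nsets_def)
    ultimately show ?thesis by (simp add: available_def uncovered_def)
  qed
  then show ?thesis by (simp add: uncovered_prob_def)
qed

section \<open>From uncovered probabilities to the expected density\<close>

lemma card_greedy_family_le:
  assumes V: "finite V" and w: "set w \<subseteq> nsets V k"
  shows "card (greedy_family t w) * (k choose t) \<le> card V choose t"
proof -
  let ?F = "greedy_family t w"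
  have F: "?F \<subseteq> nsets V k" using greedy_family_subset w by blast
  have fin: "finite ?F" using finite_subset[OF F finite_imp_finite_nsets[OF V]] .
  have "card (\<Union>K\<in>?F. nsets K t) = (\<Sum>K\<in>?F. card (nsets K t))"
    using greedy_family_packing[of t w] F V fin
    by (intro card_UN_disjoint) (auto simp: pairwise_def nsets_def intro!: finite_imp_finite_nsets[unfolded nsets_def])
  also have "\<dots> = (\<Sum>K\<in>?F. k choose t)" using F by (intro sum.cong) (auto simp: nsets_def[of V])
  finally have "card ?F * (k choose t) = card (\<Union>K\<in>?F. nsets K t)" by simp
  also have "\<dots> \<le> card (nsets V t)"
    using F V by (intro card_mono finite_imp_finite_nsets) (auto simp: nsets_def)
  finally show ?thesis by simp
qed

lemma covering_density_ge_1:
  assumes V: "finite V" "t \<le> card V" and C: "is_covering V k t C"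
  shows "1 \<le> covering_density V t C"
proof -
  have fin: "finite C" using C finite_subset[OF _ finite_imp_finite_nsets[OF V(1)]] by (auto simp: is_covering_def)
  have "1 \<le> real (card {B\<in>C. T \<subseteq> B})" if "T \<in> nsets V t" for T
  proof -
    have "{B\<in>C. T \<subseteq> B} \<noteq> {}" using C that by (auto simp: is_covering_def covers_def)
    then have "0 < card {B\<in>C. T \<subseteq> B}" using fin by (simp add: card_gt_0_iff)
    then show ?thesis by linarith
  qed
  then have "(\<Sum>T\<in>nsets V t. 1) \<le> (\<Sum>T\<in>nsets V t. real (card {B\<in>C. T \<subseteq> B}))" by (rule sum_mono)
  then have "real (card (nsets V t)) \<le> (\<Sum>T\<in>nsets V t. real (card {B\<in>C. T \<subseteq> B}))" by simp
  moreover have "0 < card (nsets V t)" using V by (simp add: zero_less_binomial)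
  ultimately show ?thesis unfolding covering_density_def by (simp add: le_divide_eq)
qed

text \<open>The packing has density at most \<open>1\<close>, and each uncovered
  \<open>t\<close>-set adds at most one block.\<close>

lemma greedy_covering_density_le:
  assumes V: "finite V" and tk: "t \<le> k" "k \<le> card V" and L: "set L = nsets V k"
    and c: "\<And>T. T \<in> nsets V t \<Longrightarrow> c T \<in> nsets V k \<and> T \<subseteq> c T"
  shows "covering_density V t (greedy_covering V t c L) \<le>
    1 + real (k choose t) / real (card V choose t) *
      (\<Sum>T\<in>nsets V t. of_bool (uncovered (greedy_family t L) {T}))"
proof -
  let ?F = "greedy_family t L" and ?U = "{T\<in>nsets V t. \<not> covers (greedy_family t L) T}"
  let ?Q = "k choose t" and ?N = "card V choose t"
  have "greedy t L {} = ?F" using L tk by (intro greedy_eq_greedy_family) (auto simp: nsets_def)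
  then have C: "greedy_covering V t c L = ?F \<union> c ` ?U" by (simp add: greedy_covering_def Let_def)
  have finU: "finite ?U" using finite_imp_finite_nsets[OF V] by simp
  have N: "0 < ?N" using tk by (simp add: zero_less_binomial)
  have sub: "greedy_covering V t c L \<subseteq> nsets V k"
    using greedy_covering_is_covering[OF tk(1) L c] by (simp add: is_covering_def)
  have "card (?F \<union> c ` ?U) \<le> card ?F + card ?U"
    using card_Un_le[of ?F "c ` ?U"] card_image_le[OF finU, of c] by linarith
  then have "card (?F \<union> c ` ?U) * ?Q \<le> (card ?F + card ?U) * ?Q" by (rule mult_le_mono1)
  also have "\<dots> = card ?F * ?Q + ?Q * card ?U" by (simp add: algebra_simps)
  also have "\<dots> \<le> ?N + ?Q * card ?U" using card_greedy_family_le[OF V] L by simp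
  finally have "real (card (?F \<union> c ` ?U)) * real ?Q \<le> real ?N + real ?Q * real (card ?U)"
    by (simp flip: of_nat_mult of_nat_add)
  then have "real (card (?F \<union> c ` ?U)) * real ?Q / real ?N \<le> (real ?N + real ?Q * real (card ?U)) / real ?N"
    by (intro divide_right_mono) auto
  also have "\<dots> = 1 + real ?Q / real ?N * real (card ?U)" using N by (simp add: add_divide_distrib)
  also have "real (card ?U) = (\<Sum>T\<in>nsets V t. of_bool (uncovered ?F {T}))"
    using finite_imp_finite_nsets[OF V] by (simp add: uncovered_def Int_def)
  finally show ?thesis unfolding covering_density_eq[OF V sub] by (simp only: C)
qed

text \<open>Averaging the pointwise bound over all orderings turns the indicators into
  \<open>uncovered_prob\<close> at the final time; the number of \<open>t\<close>-sets cancels. The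
  added blocks may depend on the ordering \<open>L\<close>.\<close>

lemma expected_density_bounds:
  assumes V: "finite V" and tk: "t \<le> k" "k \<le> card V"
    and c: "\<And>L T. L \<in> permutations_of_set (nsets V k) \<Longrightarrow> T \<in> nsets V t
      \<Longrightarrow> c L T \<in> nsets V k \<and> T \<subseteq> c L T"
    and \<epsilon>: "\<And>T. T \<in> nsets V t \<Longrightarrow> uncovered_prob (nsets V k) t (card (nsets V k)) {T} \<le> \<epsilon>"
  defines "X \<equiv> measure_pmf.expectation (random_ordering V k)
    (\<lambda>L. covering_density V t (greedy_covering V t (c L) L))"
  shows "1 \<le> X" "X \<le> 1 + real (k choose t) * \<epsilon>"
proof -
  let ?E = "nsets V k" and ?\<Pi> = "permutations_of_set (nsets V k)"
  let ?g = "\<lambda>L. covering_density V t (greedy_covering V t (c L) L)"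
  let ?r = "real (k choose t) / real (card V choose t)"
  have finE: "finite ?E" using V by (rule finite_imp_finite_nsets)
  have fin: "finite ?\<Pi>" "?\<Pi> \<noteq> {}" using finE by auto
  have setL: "set L = ?E" if "L \<in> ?\<Pi>" for L using that by (auto simp: permutations_of_set_def)
  have words: "words ?E (card ?E) = ?\<Pi>" by (rule words_card_eq_permutations[OF finE])
  have pos: "0 < real (card ?\<Pi>)" using fin by (simp only: of_nat_0_less_iff card_gt_0_iff) simp
  have X: "X = sum ?g ?\<Pi> / real (card ?\<Pi>)"
    unfolding X_def random_ordering_def using fin by (rule integral_pmf_of_set[rotated])
  have "(\<Sum>L\<in>?\<Pi>. 1) \<le> sum ?g ?\<Pi>"
    using V tk greedy_covering_is_covering[OF tk(1) setL c]
    by (intro sum_mono covering_density_ge_1[where k = k]) auto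
  then have "real (card ?\<Pi>) \<le> sum ?g ?\<Pi>" by (simp only: sum_constant mult_1_right)
  then show "1 \<le> X" unfolding X using pos by (simp only: le_divide_eq_1_pos)
  have "sum ?g ?\<Pi> \<le> (\<Sum>L\<in>?\<Pi>. 1 + ?r * (\<Sum>T\<in>nsets V t. of_bool (uncovered (greedy_family t L) {T})))"
    by (intro sum_mono greedy_covering_density_le[OF V tk setL c])
  also have "\<dots> = real (card ?\<Pi>) + ?r * (\<Sum>T\<in>nsets V t. \<Sum>L\<in>?\<Pi>. of_bool (uncovered (greedy_family t L) {T}))"
    unfolding sum.distrib sum_distrib_left[symmetric] by (subst sum.swap) (simp only: sum_constant mult_1_right)
  also have "\<dots> \<le> real (card ?\<Pi>) + ?r * (\<Sum>T\<in>nsets V t. \<epsilon> * real (card ?\<Pi>))"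
  proof (intro add_left_mono mult_left_mono sum_mono)
    fix T assume "T \<in> nsets V t"
    from \<epsilon>[OF this] show "(\<Sum>L\<in>?\<Pi>. of_bool (uncovered (greedy_family t L) {T})) \<le> \<epsilon> * real (card ?\<Pi>)"
      unfolding uncovered_prob_def words using pos by (simp only: pos_divide_le_eq)
  qed auto
  also have "\<dots> = (1 + real (k choose t) * \<epsilon>) * real (card ?\<Pi>)"
  proof -
    have "(\<Sum>T\<in>nsets V t. \<epsilon> * real (card ?\<Pi>)) = real (card V choose t) * (\<epsilon> * real (card ?\<Pi>))"
      by (simp only: sum_constant card_nsets)
    moreover have "0 < real (card V choose t)" using tk by (simp add: zero_less_binomial)
    ultimately show ?thesis by (simp only: times_divide_eq_left nonzero_eq_divide_eq)
      (simp add: algebra_simps)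
  qed
  finally show "X \<le> 1 + real (k choose t) * \<epsilon>"
    unfolding X using pos by (simp only: pos_divide_le_eq)
qed

theorem theorem3:
  fixes k t :: nat
    and c :: "nat \<Rightarrow> nat set list \<Rightarrow> nat set \<Rightarrow> nat set"
  assumes "1 \<le> t" and "t \<le> k"
    and "\<And>v L T. k \<le> v \<Longrightarrow> L \<in> permutations_of_set (nsets {..<v} k) \<Longrightarrow> T \<in> nsets {..<v} t
           \<Longrightarrow> c v L T \<in> nsets {..<v} k \<and> T \<subseteq> c v L T"
  shows "(\<lambda>v. measure_pmf.expectation (random_ordering {..<v} k)
                (\<lambda>L. covering_density {..<v} t (greedy_covering {..<v} t (c v L) L)))
         \<longlonglongrightarrow> 1"
proof (rule tendstoI)
  fix \<eta> :: real assume \<eta>: "0 < \<eta>"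
  \<comment> \<open>Chosen so that the excess density is at most \<open>\<eta> / 2\<close>, strictly
    below \<open>\<eta>\<close>.\<close>
  define \<epsilon> where "\<epsilon> = \<eta> / (2 * real (k choose t))"
  have Q: "0 < k choose t" using assms by (simp add: zero_less_binomial)
  then have \<epsilon>: "0 < \<epsilon>" "real (k choose t) * \<epsilon> = \<eta> / 2" using \<eta> by (auto simp: \<epsilon>_def)
  have "\<forall>\<^sub>F v in sequentially. \<forall>T\<in>nsets {..<v} t.
      uncovered_prob (nsets {..<v} k) t (card (nsets {..<v} k)) {T} \<le> \<epsilon>"
  proof (cases "t = k")
    case True
    then show ?thesis
      using uncovered_prob_singleton_blocks[OF finite_lessThan] \<epsilon>(1)
      by (simp del: card_nsets)
  next
    case False
    then show ?thesis using assms \<epsilon> by (intro uncovered_prob_vanishes) auto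
  qed
  with eventually_ge_at_top[of k]
  show "\<forall>\<^sub>F v in sequentially. dist (measure_pmf.expectation (random_ordering {..<v} k)
      (\<lambda>L. covering_density {..<v} t (greedy_covering {..<v} t (c v L) L))) 1 < \<eta>"
  proof eventually_elim
    case (elim v)
    have "k \<le> card {..<v}" using elim by simp
    from expected_density_bounds[where c = "c v", OF finite_lessThan assms(2) this assms(3)[OF elim(1)] elim(2)[rule_format]]
    show ?case using \<epsilon> \<eta> unfolding dist_real_def by linarith
  qed
qed

end
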